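(* Every infinite dimensional normed linear space $X$ contains an open, convex, unbounded subset which does not contain any half-line.
   Context: Normed linear spaces are over $\mathbb{R}$ or $\mathbb{C}$. A (open straight) half-line in a normed linear space $X$ is a set of the form $\{A+tu : t\in\mathbb{R},\ t>0\}$ with $A,u\in X$ and $u\neq 0$. Unbounded means unbounded in norm. *)

theory Defs
  imports "HOL-Analysis.Analysis"
begin

(* A normed linear space over the reals or the complex numbers.  The scalar field is any
   type of class real_normed_field; both real and complex are instances, and by the
   Gelfand-Mazur theorem these are the only ones up to isometric isomorphism.
   The class real_normed_vector on the vectors supplies the norm, its topology and the
   underlying real structure (which convexity and half-lines refer to); scal_of_real
   says that this real structure is the restriction of the given scalar multiplication. *)
locale normed_linear_space = vector_space scal
  for scal :: "'k::real_normed_field \<Rightarrow> 'a::real_normed_vector \<Rightarrow> 'a" +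
  assumes norm_scal: "norm (scal c x) = norm c * norm x"
    and scal_of_real: "scal (of_real r) x = r *\<^sub>R x"

lemma normed_linear_space_real:
  "normed_linear_space (scaleR :: real \<Rightarrow> 'a::real_normed_vector \<Rightarrow> 'a)"
  by (intro normed_linear_space.intro normed_linear_space_axioms.intro real_vector.vector_space_axioms) simp_all

lemma normed_linear_space_complex:
  "normed_linear_space (times :: complex \<Rightarrow> complex \<Rightarrow> complex)"
  by unfold_locales (simp_all add: algebra_simps norm_mult scaleR_conv_of_real)

(* The dimension is taken over the scalar field 'k; the function dim cannot be used here,
   since it is 0 when there is no finite basis. *)
definition infinite_dimensional :: "('k::field \<Rightarrow> 'a::ab_group_add \<Rightarrow> 'a) \<Rightarrow> bool" where
  "infinite_dimensional scal \<longleftrightarrow>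
     vector_space scal \<and> \<not> (\<exists>B. finite_dimensional_vector_space scal B)"

definition half_line :: "'a::real_vector set \<Rightarrow> bool" where
  "half_line H \<longleftrightarrow> (\<exists>A u. u \<noteq> 0 \<and> H = {A + t *\<^sub>R u | t. t > 0})"

end

theory Submission imports Defs begin

text \<open>
  Take a subspace \<open>Y\<close> of countably infinite algebraic dimension and, by Hahn-Banach, functionals
  \<open>f n\<close> of norm at most one that norm a countable dense subset of \<open>Y\<close>; these separate the points
  of the closure of \<open>Y\<close>.  The set \<open>K\<close> of all \<open>y\<close> in \<open>Y\<close> with \<open>\<bar>f n y\<bar> \<le> n\<close> for all \<open>n\<close> is convex.
  It is unbounded, because finitely many functionals have a common nonzero zero in \<open>Y\<close>.
  The open unit neighbourhood of \<open>K\<close> is the required set: the direction \<open>u\<close> of a half-line in it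
  lies in the closure of \<open>Y\<close>, and \<open>f n u = 0\<close> for all \<open>n\<close>, hence \<open>u = 0\<close>.
\<close>

section \<open>Sublinear functionals and their shifts\<close>

definition sublinear :: "('a::real_vector \<Rightarrow> real) \<Rightarrow> bool" where
  "sublinear q \<longleftrightarrow> (\<forall>x y. q (x + y) \<le> q x + q y) \<and> (\<forall>t\<ge>0. \<forall>x. q (t *\<^sub>R x) = t * q x)"

text \<open>The inequality for \<open>t\<close> at \<open>x\<close>, combined with the same
  inequality for \<open>1/t\<close> at \<open>t *\<^sub>R x\<close>, gives equality; this spares
  half of each later homogeneity proof.\<close>

lemma sublinearI:
  assumes "q 0 = 0" and "\<And>x y. q (x + y) \<le> q x + q y"
    and le: "\<And>t x. t > 0 \<Longrightarrow> q (t *\<^sub>R x) \<le> t * q x"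
  shows "sublinear q"
proof -
  have "q (t *\<^sub>R x) = t * q x" if "t \<ge> 0" for t x
  proof (cases "t = 0")
    case False
    then have t: "t > 0" using that by simp
    have "q x \<le> (1/t) * q (t *\<^sub>R x)"
      using le[of "1/t" "t *\<^sub>R x"] t by simp
    then have "t * q x \<le> q (t *\<^sub>R x)" using t by (simp add: field_simps)
    with le[OF t, of x] show ?thesis by simp
  qed (simp add: assms(1))
  then show ?thesis using assms(2) by (simp add: sublinear_def)
qed

lemma
  assumes "sublinear q"
  shows sublinear_add: "q (x + y) \<le> q x + q y"
    and sublinear_scale: "t \<ge> 0 \<Longrightarrow> q (t *\<^sub>R x) = t * q x"
    and sublinear_zero: "q 0 = 0"
    and sublinear_minus: "- q (- x) \<le> q x"
proof -
  show add: "q (x + y) \<le> q x + q y" for x y using assms by (simp add: sublinear_def)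
  show scale: "t \<ge> 0 \<Longrightarrow> q (t *\<^sub>R x) = t * q x" for t x using assms by (simp add: sublinear_def)
  show zero: "q 0 = 0" using scale[of 0 0] by simp
  show "- q (- x) \<le> q x" using add[of x "- x"] zero by simp
qed

text \<open>The largest sublinear functional below \<open>q\<close> whose value at \<open>- a\<close> is at most \<open>- q a\<close>.\<close>

definition sublinear_shift :: "('a::real_vector \<Rightarrow> real) \<Rightarrow> 'a \<Rightarrow> 'a \<Rightarrow> real" where
  "sublinear_shift q a x = (INF t\<in>{0..}. q (x + t *\<^sub>R a) - t * q a)"

text \<open>The infimum is finite: subadditivity bounds \<open>q (s *\<^sub>R a) = s * q a\<close>
  by \<open>q (x + s *\<^sub>R a) + q (- x)\<close>, so \<open>- q (- x)\<close> is a lower bound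
  for all \<open>s\<close> at once.\<close>

lemma sublinear_shift_le:
  assumes q: "sublinear q" and t: "t \<ge> 0"
  shows "sublinear_shift q a x \<le> q (x + t *\<^sub>R a) - t * q a"
  unfolding sublinear_shift_def
proof (rule cINF_lower)
  show "bdd_below ((\<lambda>t. q (x + t *\<^sub>R a) - t * q a) ` {0..})"
  proof (rule bdd_belowI2[where m = "- q (- x)"])
    fix s :: real assume "s \<in> {0..}"
    then show "- q (- x) \<le> q (x + s *\<^sub>R a) - s * q a"
      using sublinear_add[OF q, of "x + s *\<^sub>R a" "- x"] sublinear_scale[OF q, of s a] by simp
  qed
qed (use t in simp)

lemma sublinear_shift_greatest:
  assumes "\<And>t. t \<ge> 0 \<Longrightarrow> c \<le> q (x + t *\<^sub>R a) - t * q a"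
  shows "c \<le> sublinear_shift q a x"
  unfolding sublinear_shift_def by (rule cINF_greatest) (use assms in auto)

text \<open>Parameters \<open>s\<close> for \<open>x\<close> and \<open>t\<close> for
  \<open>y\<close> combine to the admissible parameter \<open>s + t\<close> for
  \<open>x + y\<close>; scaling \<open>x\<close> by \<open>t\<close> turns the parameter
  \<open>s\<close> into \<open>t * s\<close>.\<close>

lemma sublinear_sublinear_shift:
  assumes q: "sublinear q"
  shows "sublinear (sublinear_shift q a)"
proof (rule sublinearI)
  let ?p = "sublinear_shift q a"
  have "?p 0 \<le> 0" using sublinear_shift_le[OF q, of 0 a 0] sublinear_zero[OF q] by simp
  moreover have "0 \<le> ?p 0"
    by (rule sublinear_shift_greatest) (simp add: sublinear_scale[OF q])
  ultimately show "?p 0 = 0" by simp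
  show "?p (x + y) \<le> ?p x + ?p y" for x y
  proof -
    have "?p (x + y) - (q (y + t *\<^sub>R a) - t * q a) \<le> ?p x" if t: "t \<ge> 0" for t
    proof (rule sublinear_shift_greatest)
      fix s :: real assume s: "s \<ge> 0"
      have "?p (x + y) \<le> q (x + y + (s + t) *\<^sub>R a) - (s + t) * q a"
        using s t by (intro sublinear_shift_le[OF q]) simp
      also have "q (x + y + (s + t) *\<^sub>R a) \<le> q (x + s *\<^sub>R a) + q (y + t *\<^sub>R a)"
        using sublinear_add[OF q, of "x + s *\<^sub>R a" "y + t *\<^sub>R a"] by (simp add: algebra_simps)
      finally show "?p (x + y) - (q (y + t *\<^sub>R a) - t * q a) \<le> q (x + s *\<^sub>R a) - s * q a"
        by (simp add: algebra_simps)
    qed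
    then have "?p (x + y) - ?p x \<le> ?p y"
      by (intro sublinear_shift_greatest) (simp add: algebra_simps)
    then show ?thesis by simp
  qed
  show "?p (t *\<^sub>R x) \<le> t * ?p x" if t: "t > 0" for t x
  proof -
    have "?p (t *\<^sub>R x) / t \<le> ?p x"
    proof (rule sublinear_shift_greatest)
      fix s :: real assume s: "s \<ge> 0"
      have "?p (t *\<^sub>R x) \<le> q (t *\<^sub>R x + (t * s) *\<^sub>R a) - (t * s) * q a"
        using s t by (intro sublinear_shift_le[OF q]) simp
      also have "\<dots> = t * (q (x + s *\<^sub>R a) - s * q a)"
        using sublinear_scale[OF q, of t "x + s *\<^sub>R a"] t by (simp add: algebra_simps)
      finally show "?p (t *\<^sub>R x) / t \<le> q (x + s *\<^sub>R a) - s * q a"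
        using t by (simp add: field_simps)
    qed
    then show ?thesis using t by (simp add: field_simps)
  qed
qed

section \<open>Minimal sublinear functionals and Hahn-Banach\<close>

text \<open>The pointwise infimum works; it is finite because every member is at least
  \<open>- p (- x)\<close> at \<open>x\<close>. For subadditivity the infima at \<open>x\<close> and
  \<open>y\<close> may come from different members \<open>q\<close> and \<open>r\<close>, and the
  chain condition replaces both by the smaller one.\<close>

lemma sublinear_chain_bound:
  assumes C: "C \<noteq> {}" "\<And>q. q \<in> C \<Longrightarrow> sublinear q \<and> q \<le> p"
    and chain: "\<And>q r. q \<in> C \<Longrightarrow> r \<in> C \<Longrightarrow> q \<le> r \<or> r \<le> q"
  shows "\<exists>m. sublinear m \<and> (\<forall>q\<in>C. m \<le> q)"
proof -
  define m where "m x = (INF q\<in>C. q x)" for x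
  have low: "m x \<le> q x" if "q \<in> C" for q x
    unfolding m_def
  proof (rule cINF_lower[OF _ that])
    have "- p (- x) \<le> r x" if "r \<in> C" for r
      using C(2)[OF that] sublinear_minus[of r x] le_funD[of r p "- x"] by linarith
    then show "bdd_below ((\<lambda>q. q x) ` C)" by (rule bdd_belowI2)
  qed
  have great: "c \<le> m x" if "\<And>q. q \<in> C \<Longrightarrow> c \<le> q x" for c x
    unfolding m_def using C(1) that by (rule cINF_greatest)
  have "sublinear m"
  proof (rule sublinearI)
    obtain q where "q \<in> C" using C(1) by blast
    show "m 0 = 0"
      using low[OF \<open>q \<in> C\<close>, of 0] great[of 0 0] C(2) sublinear_zero \<open>q \<in> C\<close> by fastforce
    show "m (x + y) \<le> m x + m y" for x y
    proof -
      have le: "m (x + y) \<le> q x + r y" if q: "q \<in> C" and r: "r \<in> C" for q r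
      proof -
        obtain s where s: "s \<in> C" "s \<le> q" "s \<le> r" using chain[OF q r] q r by blast
        have "m (x + y) \<le> s x + s y"
          using low[OF s(1), of "x + y"] sublinear_add[of s x y] C(2)[OF s(1)] by linarith
        then show ?thesis using le_funD[OF s(2), of x] le_funD[OF s(3), of y] by linarith
      qed
      have "m (x + y) - r y \<le> m x" if "r \<in> C" for r
        by (rule great) (use le[OF _ that] in \<open>simp add: algebra_simps\<close>)
      then have "m (x + y) - m x \<le> m y"
        by (intro great) (simp add: algebra_simps)
      then show ?thesis by simp
    qed
    show "m (t *\<^sub>R x) \<le> t * m x" if t: "t > 0" for t x
    proof -
      have "m (t *\<^sub>R x) / t \<le> m x"
      proof (rule great)
        fix q assume q: "q \<in> C"
        show "m (t *\<^sub>R x) / t \<le> q x"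
          using low[OF q, of "t *\<^sub>R x"] sublinear_scale[of q t x] C(2)[OF q] t
          by (simp add: field_simps)
      qed
      then show ?thesis using t by (simp add: field_simps)
    qed
  qed
  then show ?thesis using low by (auto simp: le_fun_def)
qed

text \<open>A minimal sublinear functional \<open>q\<close> equals all its shifts, which forces additivity.\<close>

lemma exists_linear_le_sublinear:
  fixes p :: "'a::real_vector \<Rightarrow> real"
  assumes p: "sublinear p"
  shows "\<exists>f. linear f \<and> f \<le> p"
proof -
  define A where "A = {q. sublinear q \<and> q \<le> p}"
  have "\<exists>m\<in>A. \<forall>a\<in>A. a \<le> m \<longrightarrow> a = m"
  \<comment> \<open>The order is reversed, so that maximality in Zorn's lemma means minimality of
    the functional.\<close>
  proof (rule predicate_Zorn)
    show "partial_order_on A (relation_of (\<lambda>q r. r \<le> q) A)"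
      by (rule partial_order_on_relation_ofI) auto
    fix C assume C: "C \<in> Chains (relation_of (\<lambda>q r. r \<le> q) A)"
    have CA: "q \<in> C \<Longrightarrow> q \<in> A" for q using C by (auto simp: Chains_def relation_of_def)
    show "\<exists>u\<in>A. \<forall>a\<in>C. u \<le> a"
    proof (cases "C = {}")
      case True
      then show ?thesis using p by (auto simp: A_def)
    next
      case False
      have "\<exists>m. sublinear m \<and> (\<forall>q\<in>C. m \<le> q)"
        by (rule sublinear_chain_bound[OF False, of p])
          (use CA C in \<open>auto simp: A_def Chains_def relation_of_def\<close>)
      then obtain m where m: "sublinear m" "\<forall>q\<in>C. m \<le> q" by blast
      moreover obtain q where "q \<in> C" using False by blast
      ultimately have "m \<in> A" using CA[of q] by (force simp: A_def intro: order_trans)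
      then show ?thesis using m(2) by blast
    qed
  qed
  then obtain q where q: "sublinear q" "q \<le> p"
    and min: "\<And>r. sublinear r \<Longrightarrow> r \<le> q \<Longrightarrow> r = q"
    unfolding A_def by (auto intro: order_trans)
  have add: "q (x + a) = q x + q a" for x a
  proof -
    have "sublinear_shift q a \<le> q"
      using sublinear_shift_le[OF q(1), of 0 a] by (simp add: le_fun_def)
    then have "sublinear_shift q a = q"
      by (intro min sublinear_sublinear_shift q(1))
    \<comment> \<open>The parameter \<open>1\<close> in the shift yields the inequality opposite to
      subadditivity.\<close>
    then have "q x \<le> q (x + a) - q a"
      using sublinear_shift_le[OF q(1), of 1 a x] by simp
    then show ?thesis using sublinear_add[OF q(1), of x a] by simp
  qed
  have neg: "q (- x) = - q x" for x
    using add[of x "- x"] sublinear_zero[OF q(1)] by simp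
  have "linear q"
  proof (rule linearI)
    show "q (t *\<^sub>R x) = t *\<^sub>R q x" for t x
    proof (cases "t \<ge> 0")
      case False
      then show ?thesis
        using sublinear_scale[OF q(1), of "- t" x] neg[of "t *\<^sub>R x"] by simp
    qed (simp add: sublinear_scale[OF q(1)])
  qed (rule add)
  with q(2) show ?thesis by blast
qed

text \<open>A linear \<open>f\<close> below the shift of the norm along \<open>y\<close> satisfies
  \<open>f (- y) \<le> norm (- y + y) - norm y = - norm y\<close>, which forces
  \<open>f y = norm y\<close>; the parameter \<open>0\<close> gives the norm bound.\<close>

lemma exists_norming_functional:
  fixes y :: "'a::real_normed_vector"
  shows "\<exists>f. linear f \<and> (\<forall>x. \<bar>f x\<bar> \<le> norm x) \<and> f y = norm y"
proof -
  have n: "sublinear (norm :: 'a \<Rightarrow> real)"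
    by (simp add: sublinear_def norm_triangle_ineq)
  obtain f where f: "linear f" "f \<le> sublinear_shift norm y"
    using exists_linear_le_sublinear[OF sublinear_sublinear_shift[OF n]] by blast
  have le: "f x \<le> norm (x + t *\<^sub>R y) - t * norm y" if "t \<ge> 0" for x t
    using le_funD[OF f(2), of x] sublinear_shift_le[OF n that, of y x] by linarith
  have abs: "\<bar>f x\<bar> \<le> norm x" for x
    using le[of 0 x] le[of 0 "- x"] linear_neg[OF f(1), of x] by simp
  moreover have "f y = norm y"
    using le[of 1 "- y"] linear_neg[OF f(1), of y] abs[of y] by simp
  ultimately show ?thesis using f(1) by blast
qed

section \<open>Separability and dimension of spans\<close>

text \<open>Finite lists of rationals are countable and serve as coefficient vectors of
  approximating combinations.\<close>

lemma countable_dense_in_span_range: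
  fixes e :: "nat \<Rightarrow> 'a::real_normed_vector"
  shows "\<exists>d :: nat \<Rightarrow> 'a. \<forall>x\<in>span (range e). \<forall>\<epsilon>>0. \<exists>n. norm (x - d n) < \<epsilon>"
proof -
  define D where "D = range (\<lambda>rs::rat list. \<Sum>i<length rs. of_rat (rs ! i) *\<^sub>R e i)"
  have "countable D" unfolding D_def by simp
  have D: "\<exists>z\<in>D. norm (x - z) < \<epsilon>" if x: "x \<in> span (range e)" and \<epsilon>: "\<epsilon> > 0" for x and \<epsilon> :: real
  proof -
    have "\<exists>n c. x = (\<Sum>i<n. c i *\<^sub>R e i)"
      using x
    proof (induction rule: span_induct_alt)
      case base
      have "0 = (\<Sum>i<0. 0 *\<^sub>R e i)" by simp
      then show ?case by (intro exI)
    next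
      case (step a v y)
      then obtain n c where yc: "y = (\<Sum>i<n. c i *\<^sub>R e i)" by (elim exE)
      obtain j where j: "v = e j" using step by blast
      \<comment> \<open>Both summands are padded with zero coefficients to a common length that
        includes the index \<open>j\<close>.\<close>
      define N where "N = max n (Suc j)"
      have "y = (\<Sum>i<N. (if i < n then c i else 0) *\<^sub>R e i)"
        unfolding yc by (rule sum.mono_neutral_cong_left) (auto simp: N_def)
      moreover have "a *\<^sub>R v = (\<Sum>i<N. (if i = j then a else 0) *\<^sub>R e i)"
        by (simp add: j N_def less_max_iff_disj if_distrib[of "\<lambda>c. c *\<^sub>R _"] cong: if_cong)
      ultimately have "a *\<^sub>R v + y =
          (\<Sum>i<N. ((if i = j then a else 0) + (if i < n then c i else 0)) *\<^sub>R e i)"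
        by (simp add: scaleR_add_left sum.distrib)
      then show ?case by (intro exI)
    qed
    then obtain n c where xc: "x = (\<Sum>i<n. c i *\<^sub>R e i)" by (elim exE)
    \<comment> \<open>The added \<open>1\<close> keeps \<open>M\<close> positive and makes the final
      estimate \<open>\<epsilon> / M * (M - 1) < \<epsilon>\<close> strict.\<close>
    define M where "M = (\<Sum>i<n. norm (e i)) + 1"
    have M: "M > 0" unfolding M_def by (simp add: add_nonneg_pos sum_nonneg)
    have "\<exists>r::rat. \<bar>c i - of_rat r\<bar> < \<epsilon> / M" for i
    proof -
      have "c i - \<epsilon>/M < c i + \<epsilon>/M" using M \<epsilon> by (simp add: field_simps)
      then obtain r where "c i - \<epsilon>/M < of_rat r" "of_rat r < c i + \<epsilon>/M" using of_rat_dense by blast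
      then have "\<bar>c i - of_rat r\<bar> < \<epsilon> / M" by linarith
      then show ?thesis by blast
    qed
    then obtain r :: "nat \<Rightarrow> rat" where r: "\<And>i. \<bar>c i - of_rat (r i)\<bar> < \<epsilon> / M" by metis
    define z where "z = (\<Sum>i<n. of_rat (r i) *\<^sub>R e i)"
    have "z = (\<Sum>i<length (map r [0..<n]). of_rat (map r [0..<n] ! i) *\<^sub>R e i)"
      unfolding z_def by (rule sum.cong) auto
    then have "z \<in> D" unfolding D_def by (rule image_eqI) simp
    moreover have "norm (x - z) < \<epsilon>"
    proof -
      have "norm (x - z) = norm (\<Sum>i<n. (c i - of_rat (r i)) *\<^sub>R e i)"
        by (simp add: xc z_def sum_subtractf scaleR_diff_left)
      also have "\<dots> \<le> (\<Sum>i<n. \<epsilon> / M * norm (e i))"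
        by (rule sum_norm_le) (simp only: norm_scaleR real_norm_def mult_right_mono less_imp_le[OF r] norm_ge_zero)
      also have "\<dots> = \<epsilon> / M * (M - 1)" by (simp add: M_def sum_distrib_left)
      also have "\<dots> < \<epsilon>" using M \<epsilon> by (simp add: field_simps)
      finally show ?thesis .
    qed
    ultimately show ?thesis by blast
  qed
  show ?thesis
  proof (intro exI[of _ "from_nat_into D"] ballI allI impI)
    fix x and \<epsilon> :: real assume "x \<in> span (range e)" "\<epsilon> > 0"
    then obtain z where z: "z \<in> D" "norm (x - z) < \<epsilon>" using D by blast
    then show "\<exists>n. norm (x - from_nat_into D n) < \<epsilon>"
      using from_nat_into_surj[OF \<open>countable D\<close>] by metis
  qed
qed

text \<open>Each further functional cuts the dimension by at most one: if
  \<open>f N v \<noteq> 0\<close>, subtracting a multiple of \<open>v\<close> moves any vector into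
  the kernel of \<open>f N\<close>. Since \<open>v\<close> joins the spanning set, the induction is
  over arbitrary \<open>B\<close>.\<close>

lemma kernels_not_in_finite_span:
  fixes f :: "nat \<Rightarrow> 'a::real_vector \<Rightarrow> real"
  assumes lin: "\<And>i. linear (f i)" and Y: "subspace Y"
    and inf: "\<And>B. finite B \<Longrightarrow> \<not> Y \<subseteq> span B"
  shows "finite B \<Longrightarrow> \<not> {y\<in>Y. \<forall>i<N. f i y = 0} \<subseteq> span B"
proof (induction N arbitrary: B)
  case 0
  then show ?case using inf by simp
next
  case (Suc N)
  let ?V = "{y\<in>Y. \<forall>i<N. f i y = 0}" and ?W = "{y\<in>Y. \<forall>i<Suc N. f i y = 0}"
  show ?case
  proof
    assume W: "?W \<subseteq> span B"
    show False
    proof (cases "\<exists>v\<in>?V. f N v \<noteq> 0")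
      case False
      then have "?V \<subseteq> ?W" by (auto simp: less_Suc_eq)
      with W Suc.IH[OF Suc.prems] show False by (meson order_trans)
    next
      case True
      then obtain v where v: "v \<in> ?V" "f N v \<noteq> 0" by blast
      have "?V \<subseteq> span (insert v B)"
      proof
        fix y assume y: "y \<in> ?V"
        let ?c = "f N y / f N v"
        have "y - ?c *\<^sub>R v \<in> ?W"
          using y v Y lin by (auto simp: less_Suc_eq linear_diff linear_scale subspace_diff subspace_scale)
        then have "y - ?c *\<^sub>R v \<in> span B" using W by blast
        then show "y \<in> span (insert v B)" by (auto simp: span_insert)
      qed
      then show False using Suc.IH[of "insert v B"] Suc.prems by simp
    qed
  qed
qed

text \<open>This passes from dimension over \<open>'k\<close> to dimension over the reals. By
  \<open>scal_of_real\<close> a real spanning set also spans over \<open>'k\<close>, so a finite one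
  would contain a finite basis over \<open>'k\<close>.\<close>

lemma infinite_dimensional_imp_infinite_real_basis:
  fixes scal :: "'k::real_normed_field \<Rightarrow> 'a::real_normed_vector \<Rightarrow> 'a" and B :: "'a set"
  assumes "normed_linear_space scal" and inf: "infinite_dimensional scal" and B: "span B = UNIV"
  shows "infinite B"
proof
  assume fin: "finite B"
  interpret V: normed_linear_space scal by fact
  have "x \<in> V.span B" if "x \<in> span B" for x
    using that
    by (induction rule: span_induct_alt)
      (auto simp: V.span_zero V.scal_of_real[symmetric] intro: V.span_add V.span_scale V.span_base)
  then have BU: "V.span B = UNIV" using B by auto
  obtain C where C: "C \<subseteq> B" "V.independent C" "B \<subseteq> V.span C"
    using V.maximal_independent_subset[of B] by blast
  have "V.span C = UNIV" using V.span_minimal[OF C(3) V.subspace_span] BU by auto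
  then have "finite_dimensional_vector_space scal C"
    using C fin by unfold_locales (auto intro: finite_subset)
  then show False using inf by (auto simp: infinite_dimensional_def)
qed

text \<open>An injective sequence in a real basis is independent, and a finite span contains no
  infinite independent set.\<close>

lemma exists_sequence_infinite_dimensional_span:
  assumes "\<And>B :: 'a::real_vector set. span B = UNIV \<Longrightarrow> infinite B"
  shows "\<exists>e :: nat \<Rightarrow> 'a. \<forall>B. finite B \<longrightarrow> \<not> span (range e) \<subseteq> span B"
proof -
  obtain B :: "'a set" where B: "independent B" "UNIV \<subseteq> span B"
    by (rule maximal_independent_subset)
  then have "infinite B" by (intro assms) auto
  then obtain e :: "nat \<Rightarrow> 'a" where e: "inj e" "range e \<subseteq> B"
    using infinite_countable_subset by blast
  have ind: "independent (range e)" using independent_mono[OF B(1) e(2)] .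
  have "\<not> span (range e) \<subseteq> span C" if "finite C" for C
  proof
    assume "span (range e) \<subseteq> span C"
    then have "range e \<subseteq> span C" using span_superset by blast
    then have "finite (range e)" using independent_span_bound[OF that ind] by blast
    then show False using e(1) finite_imageD by blast
  qed
  then show ?thesis by blast
qed

section \<open>The neighbourhood of \<open>K\<close> and the directions of its half-lines\<close>

theorem theorem4p2:
  fixes scal :: "'k::real_normed_field \<Rightarrow> 'a::real_normed_vector \<Rightarrow> 'a"
  assumes "normed_linear_space scal"
    and "infinite_dimensional scal"
  shows "\<exists>S :: 'a set. open S \<and> convex S \<and> \<not> bounded S \<and>
           \<not> (\<exists>H. half_line H \<and> H \<subseteq> S)"
proof -
  obtain e :: "nat \<Rightarrow> 'a" where e: "\<And>B. finite B \<Longrightarrow> \<not> span (range e) \<subseteq> span B"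
    using exists_sequence_infinite_dimensional_span
      infinite_dimensional_imp_infinite_real_basis[OF assms] by metis
  define Y where "Y = span (range e)"
  have Y: "subspace Y" unfolding Y_def by (rule subspace_span)
  obtain d :: "nat \<Rightarrow> 'a" where d: "\<And>x \<epsilon>. x \<in> Y \<Longrightarrow> \<epsilon> > 0 \<Longrightarrow> \<exists>n. norm (x - d n) < \<epsilon>"
    unfolding Y_def using countable_dense_in_span_range by metis
  have "\<forall>n. \<exists>g. linear g \<and> (\<forall>x. \<bar>g x\<bar> \<le> norm x) \<and> g (d n) = norm (d n)"
    using exists_norming_functional by blast
  from choice[OF this] obtain f :: "nat \<Rightarrow> 'a \<Rightarrow> real" where lin: "\<And>n. linear (f n)"
    and f: "\<And>n x. \<bar>f n x\<bar> \<le> norm x" and fd: "\<And>n. f n (d n) = norm (d n)"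
    by blast
  \<comment> \<open>The bounds grow with \<open>n\<close>: each \<open>f n\<close> stays bounded on
    \<open>K\<close>, yet a vector of norm \<open>N\<close> meets every constraint with
    \<open>n \<ge> N\<close> automatically.\<close>
  define K where "K = {y\<in>Y. \<forall>n. \<bar>f n y\<bar> \<le> real n}"
  define S where "S = (\<Union>y\<in>K. ball y 1)"
  have "convex K"
  proof -
    have "K = Y \<inter> (\<Inter>n. f n -` {- real n..real n})"
      by (auto simp: K_def abs_le_iff minus_le_iff)
    also have "convex \<dots>"
      by (intro convex_Int convex_INT convex_linear_vimage lin subspace_imp_convex[OF Y]
          convex_real_interval)
    finally show ?thesis .
  qed
  have "convex S"
  proof -
    \<comment> \<open>Written as the Minkowski sum of the unit ball and \<open>K\<close>, the set
      falls under \<open>convex_sums\<close>.\<close>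
    have "S = (\<Union>b\<in>ball 0 1. \<Union>y\<in>K. {b + y})"
    proof (intro set_eqI iffI)
      fix x assume "x \<in> S"
      then obtain y where "y \<in> K" "x - y \<in> ball 0 1"
        by (auto simp: S_def dist_norm norm_minus_commute)
      moreover have "x = (x - y) + y" by simp
      ultimately show "x \<in> (\<Union>b\<in>ball 0 1. \<Union>y\<in>K. {b + y})" by blast
    next
      fix x assume "x \<in> (\<Union>b\<in>ball 0 1. \<Union>y\<in>K. {b + y})"
      then obtain b y where "y \<in> K" "norm b < 1" "x = b + y" by auto
      then show "x \<in> S" unfolding S_def by (intro UN_I[of y]) (auto simp: dist_norm)
    qed
    with \<open>convex K\<close> show ?thesis by (auto intro: convex_sums)
  qed
  moreover have "open S" unfolding S_def by blast
  moreover have "\<not> bounded S"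
  proof
    assume "bounded S"
    then obtain M where M: "\<And>x. x \<in> S \<Longrightarrow> norm x \<le> M" by (auto simp: bounded_iff)
    obtain N :: nat where N: "real N > M" using reals_Archimedean2 by blast
    \<comment> \<open>As \<open>span {}\<close> is the zero space, this produces a nonzero common
      zero of the first \<open>N\<close> functionals.\<close>
    have "\<not> {y\<in>Y. \<forall>i<N. f i y = 0} \<subseteq> span {}"
      by (rule kernels_not_in_finite_span[OF lin Y]) (use e in \<open>auto simp: Y_def\<close>)
    then obtain y where y: "y \<in> Y" "\<And>i. i < N \<Longrightarrow> f i y = 0" "y \<noteq> 0" by auto
    \<comment> \<open>At norm exactly \<open>N\<close>, the constraints below \<open>N\<close> hold
      because \<open>f n z = 0\<close>, the others because
      \<open>\<bar>f n z\<bar> \<le> N \<le> n\<close>.\<close>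
    define z where "z = (real N / norm y) *\<^sub>R y"
    have nz: "norm z = real N" using y(3) by (simp add: z_def)
    have "\<bar>f n z\<bar> \<le> real n" for n
    proof (cases "n < N")
      case True
      then show ?thesis by (simp add: z_def linear_scale[OF lin] y(2))
    next
      case False
      then show ?thesis using f[of n z] nz by simp
    qed
    then have "z \<in> K" using y(1) Y by (simp add: K_def z_def subspace_scale)
    then have "z \<in> S" unfolding S_def by force
    with M nz N show False by force
  qed
  moreover have "\<not> (\<exists>H. half_line H \<and> H \<subseteq> S)"
  proof
    assume "\<exists>H. half_line H \<and> H \<subseteq> S"
    then obtain A u where u: "u \<noteq> 0" and "{A + t *\<^sub>R u | t. t > 0} \<subseteq> S"
      by (auto simp: half_line_def)
    then have AS: "A + t *\<^sub>R u \<in> S" if "t > 0" for t using that by blast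
    have ex: "\<exists>y\<in>K. norm (A + t *\<^sub>R u - y) < 1" if "t > 0" for t
      using AS[OF that] by (auto simp: S_def dist_norm norm_minus_commute)
    have approx: "\<exists>y\<in>Y. norm (u - y) < \<epsilon>" if \<epsilon>: "\<epsilon> > 0" for \<epsilon>
    proof -
      \<comment> \<open>Dividing by \<open>t\<close> a point of \<open>K\<close> near
        \<open>A + t *\<^sub>R u\<close> gives a point of \<open>Y\<close> whose distance to
        \<open>u\<close> is below \<open>(1 + norm A) / t\<close>; this \<open>t\<close> makes that
        bound equal to \<open>\<epsilon>\<close>.\<close>
      define t where "t = (1 + norm A) / \<epsilon>"
      have t: "t > 0" using \<epsilon> by (simp add: t_def add_pos_nonneg)
      obtain y where y: "y \<in> K" "norm (A + t *\<^sub>R u - y) < 1" using ex[OF t] by blast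
      have "t * norm (u - (1/t) *\<^sub>R y) = norm (t *\<^sub>R (u - (1/t) *\<^sub>R y))" using t by simp
      also have "\<dots> = norm ((A + t *\<^sub>R u - y) - A)" using t by (simp add: algebra_simps)
      also have "\<dots> < 1 + norm A"
        using norm_triangle_ineq4[of "A + t *\<^sub>R u - y" A] y(2) by linarith
      also have "\<dots> = t * \<epsilon>" using \<epsilon> by (simp add: t_def)
      finally have "norm (u - (1/t) *\<^sub>R y) < \<epsilon>" using t by simp
      moreover have "(1/t) *\<^sub>R y \<in> Y" using y(1) Y by (simp add: K_def subspace_scale)
      ultimately show ?thesis by blast
    qed
    have fu: "f n u = 0" for n
    proof (rule ccontr)
      assume nz: "f n u \<noteq> 0"
      \<comment> \<open>Here \<open>t * \<bar>f n u\<bar>\<close> equals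
        \<open>1 + real n + norm A\<close>. The summands bound \<open>f n\<close> on the error
        vector (strictly), on \<open>y\<close> in \<open>K\<close> and on \<open>A\<close>, so the
        total cannot be attained.\<close>
      define t where "t = (1 + real n + norm A) / \<bar>f n u\<bar>"
      have t: "t > 0" using nz by (simp add: t_def add_pos_nonneg)
      obtain y where y: "y \<in> K" "norm (A + t *\<^sub>R u - y) < 1" using ex[OF t] by blast
      have "t * \<bar>f n u\<bar> = \<bar>f n (t *\<^sub>R u)\<bar>"
        using t by (simp add: linear_scale[OF lin] abs_mult)
      also have "f n (t *\<^sub>R u) = f n (A + t *\<^sub>R u - y) + f n y - f n A"
        by (simp add: linear_add[OF lin] linear_diff[OF lin])
      also have "\<bar>\<dots>\<bar> < 1 + real n + norm A"
        using f[of n "A + t *\<^sub>R u - y"] y f[of n A] by (auto simp: K_def dest!: spec[of _ n])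
      finally show False using nz by (simp add: t_def)
    qed
    \<comment> \<open>Two errors of a quarter put some \<open>d n\<close> within
      \<open>norm u / 2\<close> of \<open>u\<close>. As \<open>f n\<close> norms \<open>d n\<close>
      and kills \<open>u\<close>, \<open>norm (d n)\<close> is also below \<open>norm u / 2\<close>,
      which contradicts the triangle inequality.\<close>
    obtain y where y: "y \<in> Y" "norm (u - y) < norm u / 4" using approx[of "norm u / 4"] u by auto
    obtain n where n: "norm (y - d n) < norm u / 4" using d[OF y(1), of "norm u / 4"] u by auto
    have ud: "norm (u - d n) < norm u / 2"
      using norm_triangle_ineq[of "u - y" "y - d n"] y(2) n by simp
    have "norm (d n) = f n (d n - u)" by (simp add: linear_diff[OF lin] fd fu)
    also have "\<dots> \<le> norm (u - d n)" using f[of n "d n - u"] by (simp add: norm_minus_commute)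
    finally show False using ud norm_triangle_ineq[of "u - d n" "d n"] by simp
  qed
  ultimately show ?thesis by blast
qed

end
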